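(* For every positive integer $n$ and every string $x$ of length $n$ over a finite alphabet, the number of FS-double squares of $x$ is at most $\lfloor 5n/6\rfloor$.
   Context: Strings are finite, over a finite alphabet. A square is a string $u^2=uu$ with $u$ non-empty; $u$ is its generator. A double square $(u,U)$ in a string $x$ is a configuration of two squares $u^2$ and $U^2$ with $|u|<|U|$ that occur in $x$ starting at the same position. An occurrence of a square in $x$ is rightmost if the same square has no occurrence in $x$ starting at a larger position. A double square $(u,U)$ in $x$ is an FS-double square of $x$ if these occurrences of $u^2$ and $U^2$ (starting at the same position) are both rightmost occurrences in $x$. *)

theory Defs
  imports Complex_Main
begin

(* Strings are lists over an arbitrary type; positions are counted from 0. *)

definition occurs_at :: "'a list \<Rightarrow> 'a list \<Rightarrow> nat \<Rightarrow> bool" where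
  "occurs_at w x i \<longleftrightarrow> (\<exists>p s. x = p @ w @ s \<and> length p = i)"

definition square_at :: "'a list \<Rightarrow> 'a list \<Rightarrow> nat \<Rightarrow> bool" where
  "square_at u x i \<longleftrightarrow> u \<noteq> [] \<and> occurs_at (u @ u) x i"

definition rightmost_square_at :: "'a list \<Rightarrow> 'a list \<Rightarrow> nat \<Rightarrow> bool" where
  "rightmost_square_at u x i \<longleftrightarrow> square_at u x i \<and> (\<forall>j>i. \<not> square_at u x j)"

definition double_square_at :: "'a list \<Rightarrow> 'a list \<Rightarrow> 'a list \<Rightarrow> nat \<Rightarrow> bool" where
  "double_square_at u U x i \<longleftrightarrow> length u < length U \<and> square_at u x i \<and> square_at U x i"

(* A double square is a configuration in the string, so it is recorded together
   with its starting position.  Generators need not be primitive. *)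
definition FS_double_squares :: "'a list \<Rightarrow> (nat \<times> 'a list \<times> 'a list) set" where
  "FS_double_squares x = {(i, u, U). double_square_at u U x i \<and>
     rightmost_square_at u x i \<and> rightmost_square_at U x i}"

(* The cardinality of the set above is therefore a genuine count. *)
lemma finite_FS_double_squares: "finite (FS_double_squares x)"
proof (rule finite_subset)
  let ?L = "{w. set w \<subseteq> set x \<and> length w \<le> length x}"
  have L: "i \<in> {..length x} \<and> u \<in> ?L" if sq: "square_at u x i" for u i
  proof -
    obtain p s where "x = p @ (u @ u) @ s" "length p = i"
      using sq unfolding square_at_def occurs_at_def by blast
    then have "set x = set p \<union> set u \<union> set s"
      and "length x = i + length u + length u + length s"
      by auto
    then show ?thesis by auto
  qed
  show "FS_double_squares x \<subseteq> {..length x} \<times> ?L \<times> ?L"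
    unfolding FS_double_squares_def double_square_at_def using L by blast
  show "finite ({..length x} \<times> ?L \<times> ?L)"
    by (intro finite_cartesian_product finite_atMost finite_lists_length_le finite_set)
qed

end

(* Every FS-double square accounts for two distinct squares of x, because at most two rightmost
   squares start at a position; so it suffices that x has fewer than n distinct squares (Brlek, Li).
   The Rauzy graph of order m has the factors of length m as vertices and those of length m + 1 as
   edges. A periodic sequence with least period L <= m all of whose windows of length m + 1 occur
   in x is a circuit of length L in this graph. Such circuits are independent in the cycle space,
   so their number is at most #edges - #vertices + 1, and these bounds telescope over m. Distinct
   squares uu can be assigned distinct pairs (m, circuit): if r rotations of u, of root length L,
   have their squares in x, use the circuit of u for m = 2|u| - L, ..., 2|u| - L + r - 1. *)

theory Submission
  imports Defs "HOL-Library.List_Lexorder"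
begin

section \<open>Windows of sequences and periods\<close>

text \<open>Infinite sequences are a common carrier: \<open>window\<close> reads both factors of a
  string, through \<open>(!) x\<close>, and stretches of a periodic sequence.\<close>

definition window :: "(nat \<Rightarrow> 'a) \<Rightarrow> nat \<Rightarrow> nat \<Rightarrow> 'a list" where
  "window a i k = map a [i..<i + k]"

lemma length_window [simp]: "length (window a i k) = k"
  by (simp add: window_def)

lemma nth_window [simp]: "t < k \<Longrightarrow> window a i k ! t = a (i + t)"
  by (simp add: window_def)

lemma window_eq_iff: "window a i k = window b j k \<longleftrightarrow> (\<forall>t<k. a (i + t) = b (j + t))"
  by (simp add: list_eq_iff_nth_eq)

lemma tl_window: "tl (window a i (Suc k)) = window a (Suc i) k"
  by (simp add: list_eq_iff_nth_eq nth_tl)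

lemma butlast_window: "butlast (window a i (Suc k)) = window a i k"
  by (simp add: list_eq_iff_nth_eq nth_butlast)

lemma window_append: "window a i (j + k) = window a i j @ window a (i + j) k"
  by (simp add: list_eq_iff_nth_eq nth_append)

section \<open>Least periods of infinite sequences\<close>

definition least_period :: "(nat \<Rightarrow> 'a) \<Rightarrow> nat \<Rightarrow> bool" where
  "least_period a L \<longleftrightarrow> L > 0 \<and> (\<forall>i. a (i + L) = a i) \<and>
     (\<forall>p>0. (\<forall>i. a (i + p) = a i) \<longrightarrow> L \<le> p)"

lemma least_periodD:
  assumes "least_period a L"
  shows "L > 0" "a (i + L) = a i" "p > 0 \<Longrightarrow> (\<And>i. a (i + p) = a i) \<Longrightarrow> L \<le> p"
  using assms by (auto simp: least_period_def)

lemma periodic_mult: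
  fixes a :: "nat \<Rightarrow> 'a"
  assumes "\<And>i. a (i + L) = a i"
  shows "a (i + k * L) = a i"
proof (induction k)
  case (Suc k)
  have "a (i + Suc k * L) = a ((i + k * L) + L)" by (simp add: algebra_simps)
  then show ?case using assms Suc by simp
qed simp

lemma periodic_mod:
  fixes a :: "nat \<Rightarrow> 'a"
  assumes "\<And>i. a (i + L) = a i"
  shows "a (i mod L) = a i"
  using periodic_mult[of a L "i mod L" "i div L"] assms by simp

text \<open>Otherwise the remainder \<open>p mod L\<close> would be a positive period below
  \<open>L\<close>.\<close>

lemma least_period_dvd:
  assumes L: "least_period a L" and p: "\<And>i. a (i + p) = a i"
  shows "L dvd p"
proof (rule ccontr)
  assume "\<not> L dvd p"
  then have "p mod L > 0" by (simp add: dvd_eq_mod_eq_0)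
  moreover have "a (i + p mod L) = a i" for i
    using periodic_mult[of a L "i + p mod L" "p div L"] least_periodD(2)[OF L] p[of i]
    by (simp add: add.assoc)
  ultimately have "L \<le> p mod L" using least_periodD(3)[OF L] by blast
  then show False using mod_less_divisor[OF least_periodD(1)[OF L], of p] by simp
qed

lemma ex_least_period:
  fixes a :: "nat \<Rightarrow> 'a"
  assumes "p > 0" "\<And>i. a (i + p) = a i"
  shows "\<exists>L. least_period a L"
proof -
  let ?P = "\<lambda>p. p > 0 \<and> (\<forall>i. a (i + p) = a i)"
  have "?P (LEAST p. ?P p)" using assms by (intro LeastI[of ?P p]) auto
  moreover have "(LEAST p. ?P p) \<le> q" if "?P q" for q using that by (rule Least_le)
  ultimately show ?thesis unfolding least_period_def by blast
qed

lemma periodic_shift_agree: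
  fixes a b :: "nat \<Rightarrow> 'a"
  assumes a: "\<And>i. a (i + L) = a i" and b: "\<And>i. b (i + L) = b i" and "L > 0"
    and agree: "\<And>t. t < L \<Longrightarrow> a (i + t) = b (j + t)"
  shows "a (i + t) = b (j + t)"
proof -
  have "a (i + t) = a (i + t mod L)"
    using periodic_mult[of a L "i + t mod L" "t div L"] a by (simp add: add.assoc)
  also have "\<dots> = b (j + t mod L)" using agree \<open>L > 0\<close> by simp
  also have "\<dots> = b (j + t)"
    using periodic_mult[of b L "j + t mod L" "t div L"] b by (simp add: add.assoc)
  finally show ?thesis .
qed

text \<open>Equality over one full period propagates to all later positions, which would make
  \<open>j - i < L\<close> a period of \<open>a\<close>.\<close>

lemma window_neq:
  assumes L: "least_period a L" and "L \<le> k" "i < j" "j < i + L"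
  shows "window a i k \<noteq> window a j k"
proof
  assume "window a i k = window a j k"
  then have *: "\<And>t. t < L \<Longrightarrow> a (i + t) = a (j + t)" using \<open>L \<le> k\<close> by (simp add: window_eq_iff)
  have "a (i + t) = a (j + t)" for t
    using periodic_shift_agree[of a L a i j] * least_periodD(1,2)[OF L] by blast
  note ** = this
  have "a (t + (j - i)) = a t" for t
  proof -
    \<comment> \<open>Adding \<open>i * L\<close> moves \<open>t\<close> past \<open>i\<close>, so
      that no subtraction is truncated.\<close>
    have "a t = a (t + i * L)" using periodic_mult[of a L t i] least_periodD(2)[OF L] by simp
    moreover have "t + i * L = i + (t + i * L - i)" using least_periodD(1)[OF L]
      by (simp add: trans_le_add2)
    moreover have "j + (t + i * L - i) = t + (j - i) + i * L" using least_periodD(1)[OF L] \<open>i < j\<close>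
      by (simp add: trans_le_add2)
    ultimately show ?thesis
      using ** periodic_mult[of a L "t + (j - i)" i] least_periodD(2)[OF L] by metis
  qed
  then have "L \<le> j - i" using least_periodD(3)[OF L, of "j - i"] \<open>i < j\<close> by auto
  then show False using assms by linarith
qed

lemma inj_on_window:
  assumes L: "least_period a L" and "L \<le> k"
  shows "inj_on (\<lambda>i. window a i k) {..<L}"
proof (rule inj_onI)
  fix i j assume ij: "i \<in> {..<L}" "j \<in> {..<L}" and eq: "window a i k = window a j k"
  then have "\<not> i < j" "\<not> j < i"
    using window_neq[OF L \<open>L \<le> k\<close>, of i j] window_neq[OF L \<open>L \<le> k\<close>, of j i] by auto
  then show "i = j" by simp
qed

text \<open>For periodic \<open>a\<close>, the edge set of a closed walk in the Rauzy graph of order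
  \<open>k - 1\<close>; as a set it forgets where the walk starts.\<close>

definition circuit :: "(nat \<Rightarrow> 'a) \<Rightarrow> nat \<Rightarrow> 'a list set" where
  "circuit a k = range (\<lambda>i. window a i k)"

lemma window_mod:
  assumes "\<And>i. a (i + L) = a i"
  shows "window a (i mod L) k = window a i k"
proof -
  have "a (i mod L + t) = a (i + t)" for t
    using periodic_mult[of a L "i mod L + t" "i div L"] assms by (simp add: algebra_simps)
  then show ?thesis by (simp add: window_eq_iff)
qed

lemma circuit_eq_image:
  assumes "least_period a L"
  shows "circuit a k = (\<lambda>i. window a i k) ` {..<L}"
proof -
  have "window a i k \<in> (\<lambda>i. window a i k) ` {..<L}" for i
    by (rule image_eqI[of _ _ "i mod L"])
      (use assms in \<open>simp_all add: window_mod least_periodD\<close>)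
  then show ?thesis by (auto simp: circuit_def)
qed

lemma card_circuit:
  assumes "least_period a L" "L \<le> k"
  shows "card (circuit a k) = L" "finite (circuit a k)"
  using assms by (simp_all add: circuit_eq_image card_image inj_on_window)

text \<open>The least rotation is unbordered: if \<open>q z = z q'\<close> is least, comparing with the rotations
  \<open>z q\<close> and \<open>q' z\<close> gives \<open>q = q'\<close>, and two distinct rotations coincide.\<close>

lemma ex_unbordered_nat:
  fixes a :: "nat \<Rightarrow> nat"
  assumes L: "least_period a L"
  shows "\<exists>i. \<forall>p. 0 < p \<and> p < L \<longrightarrow> (\<exists>t. t + p < L \<and> a (i + t) \<noteq> a (i + t + p))"
proof -
  let ?w = "\<lambda>i. window a i L"
  have "finite (circuit a L)" using card_circuit[OF L] by simp
  moreover have "circuit a L \<noteq> {}" by (simp add: circuit_def)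
  ultimately have "Min (circuit a L) \<in> circuit a L" "\<And>i. Min (circuit a L) \<le> ?w i"
    by (auto simp: circuit_def)
  then obtain i where i: "\<And>j. ?w i \<le> ?w j" by (force simp: circuit_def)
  show ?thesis
  proof (rule exI[of _ i], intro allI impI, rule ccontr)
    fix p assume p: "0 < p \<and> p < L" and "\<not> (\<exists>t. t + p < L \<and> a (i + t) \<noteq> a (i + t + p))"
    then have per: "\<And>t. t + p < L \<Longrightarrow> a (i + t) = a (i + p + t)" by (force simp: ac_simps)
    let ?q = "window a i p" and ?z = "window a (i + p) (L - p)" and ?q' = "window a (i + L - p) p"
    have z: "?z = window a i (L - p)" using per by (simp add: window_eq_iff)
    have q: "window a (i + L) p = ?q" using least_periodD(2)[OF L]
      by (simp add: window_eq_iff) (metis add.assoc add.commute)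
    have w1: "?w i = ?q @ ?z" using window_append[of a i p "L - p"] p by simp
    have w2: "?w i = ?z @ ?q'" using window_append[of a i "L - p" p] p z by simp
    have w3: "?w (i + p) = ?z @ ?q" using window_append[of a "i + p" "L - p" p] p q by simp
    have z': "window a (i + L) (L - p) = ?z"
      using least_periodD(2)[OF L] z
      by (simp add: window_eq_iff) (metis add.assoc add.commute)
    have w4: "?w (i + L - p) = ?q' @ ?z"
      using window_append[of a "i + L - p" p "L - p"] p z' by simp
    have "?q' \<le> ?q"
      using i[of "i + p"] unfolding w2 w3 by (auto simp: list_le_def list_less_def dest: lexord_append_leftD)
    \<comment> \<open>The two words have equal length, so a strict inequality would survive
      appending \<open>?z\<close> and put the rotation at \<open>i + L - p\<close> below the least
      one.\<close>
    moreover have "\<not> ?q' < ?q"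
    proof
      assume "?q' < ?q"
      then have "?q' @ ?z < ?q @ ?z" unfolding list_less_def by (rule lexord_sufI) simp
      then show False using i[of "i + L - p"] unfolding w1 w4 by simp
    qed
    ultimately have "?w i = ?w (i + p)" using w2 w3 by simp
    then show False using window_neq[OF L order_refl, of i "i + p"] p by simp
  qed
qed

text \<open>A periodic sequence has finitely many letters. Coding them injectively by naturals
  supplies an order, and the conclusion depends only on equality of letters.\<close>

lemma ex_unbordered:
  assumes L: "least_period a L"
  shows "\<exists>i. \<forall>p. 0 < p \<and> p < L \<longrightarrow> (\<exists>t. t + p < L \<and> a (i + t) \<noteq> a (i + t + p))"
proof -
  have "range a = a ` {..<L}"
  proof -
    have "a i \<in> a ` {..<L}" for i
      by (rule image_eqI[of _ _ "i mod L"])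
        (use L in \<open>simp_all add: periodic_mod least_periodD\<close>)
    then show ?thesis by auto
  qed
  then have "finite (range a)" by (metis finite_imageI finite_lessThan)
  then obtain f :: "'a \<Rightarrow> nat" where f: "inj_on f (range a)"
    using finite_imp_inj_to_nat_seg by blast
  then have eq: "f (a i) = f (a j) \<longleftrightarrow> a i = a j" for i j by (auto simp: inj_on_def)
  have "least_period (\<lambda>i. f (a i)) L" using L by (simp add: least_period_def eq)
  from ex_unbordered_nat[OF this] show ?thesis by (simp add: eq)
qed

text \<open>A common window of at least one period determines both sequences up to a shift, hence
  their circuits of every order.\<close>

lemma circuit_eqI:
  assumes a: "least_period a L" and b: "least_period b L" and "L \<le> k"
    and w: "window a i k = window b j k"
  shows "circuit a n = circuit b n"
proof -
  have *: "window a' i' n \<in> circuit b' n"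
    if a: "least_period a' L" and b: "least_period b' L" and w: "window a' i k = window b' j k"
    for a' b' :: "nat \<Rightarrow> 'a" and i j i'
  proof -
    have agree: "a' (i + t) = b' (j + t)" for t
      using periodic_shift_agree[of a' L b' i j] least_periodD(1,2)[OF a] least_periodD(1,2)[OF b]
        w \<open>L \<le> k\<close> by (simp add: window_eq_iff)
    have "a' (i' + t) = b' (j + (i' + i * L - i) + t)" for t
    proof -
      have "i \<le> i' + i * L" using least_periodD(1)[OF a] by (simp add: trans_le_add2)
      then have "i + ((i' + i * L - i) + t) = i' + t + i * L" by simp
      then show ?thesis
        using agree[of "(i' + i * L - i) + t"] periodic_mult[of a' L "i' + t" i] least_periodD(2)[OF a]
        by (simp add: add.assoc add.commute[of t "i * L"])
    qed
    then have "window a' i' n = window b' (j + (i' + i * L - i)) n" by (simp add: window_eq_iff)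
    then show ?thesis by (simp add: circuit_def)
  qed
  show ?thesis
    using *[OF a b w] *[OF b a w[symmetric]] unfolding circuit_def by blast
qed

section \<open>Edge counting in connected graphs\<close>

text \<open>Undirected adjacency in a multigraph with end point maps \<open>s\<close> and
  \<open>t\<close>: walks may use edges in either direction.\<close>

definition links :: "('e \<Rightarrow> 'v) \<Rightarrow> ('e \<Rightarrow> 'v) \<Rightarrow> 'e set \<Rightarrow> ('v \<times> 'v) set" where
  "links s t E = (\<lambda>e. (s e, t e)) ` E \<union> (\<lambda>e. (t e, s e)) ` E"

lemma sym_links: "sym (links s t E)"
  by (auto simp: links_def sym_def)

text \<open>Every vertex other than the root is charged to the edge leading one step closer to the root.\<close>

lemma connected_card_le:
  assumes "finite E" and conn: "\<And>v. v \<in> V \<Longrightarrow> (r, v) \<in> (links s t E)\<^sup>*"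
  shows "card V \<le> card E + 1"
proof -
  let ?R = "links s t E"
  define d where "d v = (LEAST n. (r, v) \<in> ?R ^^ n)" for v
  have d: "(r, v) \<in> ?R ^^ d v" if rv: "(r, v) \<in> ?R\<^sup>*" for v
  proof -
    obtain n where "(r, v) \<in> ?R ^^ n" using rtrancl_imp_relpow[OF rv] by auto
    then show ?thesis unfolding d_def by (rule LeastI)
  qed
  have d_le: "d v \<le> n" if "(r, v) \<in> ?R ^^ n" for v n
    using that unfolding d_def by (rule Least_le)
  have "\<exists>e\<in>E. \<exists>v'. (s e = v' \<and> t e = v \<or> s e = v \<and> t e = v') \<and> d v = Suc (d v')"
    if v: "v \<in> V - {r}" for v
  proof (cases "d v")
    case 0
    then show ?thesis using d[of v] conn[of v] v by auto
  next
    case (Suc n)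
    then have "(r, v) \<in> ?R ^^ Suc n" using d[of v] conn[of v] v by auto
    then obtain v' where v': "(r, v') \<in> ?R ^^ n" "(v', v) \<in> ?R" by auto
    have "(r, v) \<in> ?R ^^ Suc (d v')"
      using d[of v'] v' relpow_imp_rtrancl by (metis relpow_Suc_I)
    then have "Suc n \<le> Suc (d v')" using d_le[of v "Suc (d v')"] unfolding Suc by blast
    moreover have "d v' \<le> n" using d_le v' by simp
    ultimately have "d v = Suc (d v')" using Suc by simp
    then show ?thesis using v'(2) by (auto simp: links_def)
  qed
  then obtain e where e: "\<And>v. v \<in> V - {r} \<Longrightarrow> e v \<in> E \<and>
      (\<exists>v'. (s (e v) = v' \<and> t (e v) = v \<or> s (e v) = v \<and> t (e v) = v') \<and> d v = Suc (d v'))"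
    by metis
  \<comment> \<open>\<open>e v\<close> determines \<open>v\<close> as its end point farther from the
    root, since the distances of the two ends differ by one.\<close>
  have "inj_on e (V - {r})"
  proof (rule inj_onI)
    fix v w assume v: "v \<in> V - {r}" and w: "w \<in> V - {r}" and "e v = e w"
    then show "v = w" using e[OF v] e[OF w] by auto
  qed
  moreover have "e ` (V - {r}) \<subseteq> E" using e by auto
  ultimately have "card (V - {r}) \<le> card E" using \<open>finite E\<close> by (rule card_inj_on_le)
  moreover have "card V \<le> card (V - {r}) + 1" by (auto simp: card_Diff_singleton_if)
  ultimately show ?thesis by linarith
qed

text \<open>Deleting the edges \<open>h C\<close> keeps the graph connected: inductively along \<open>rank\<close>, the rest of
  the cycle \<open>C\<close> joins the end points of \<open>h C\<close>.\<close>

lemma card_independent_cycles: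
  fixes rank :: "'e set \<Rightarrow> nat"
  assumes "finite E" and conn: "\<And>v. v \<in> V \<Longrightarrow> (r, v) \<in> (links s t E)\<^sup>*"
    and sub: "\<And>C. C \<in> \<C> \<Longrightarrow> C \<subseteq> E" and h: "\<And>C. C \<in> \<C> \<Longrightarrow> h C \<in> C"
    and bridge: "\<And>C. C \<in> \<C> \<Longrightarrow> (s (h C), t (h C)) \<in> (links s t (C - {h C}))\<^sup>*"
    and rank: "\<And>C D. C \<in> \<C> \<Longrightarrow> D \<in> \<C> \<Longrightarrow> h C \<in> D \<Longrightarrow> C \<noteq> D \<Longrightarrow> rank C < rank D"
  shows "card V + card \<C> \<le> card E + 1"
proof -
  let ?E = "E - h ` \<C>"
  have symE: "sym ((links s t F)\<^sup>*)" for F by (simp add: sym_links sym_rtrancl)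
  have hC: "(s (h C), t (h C)) \<in> (links s t ?E)\<^sup>*" if "C \<in> \<C>" for C
    using that
  proof (induction "rank C" arbitrary: C rule: less_induct)
    case less
    have "(s e, t e) \<in> (links s t ?E)\<^sup>*" if e: "e \<in> C - {h C}" for e
    proof (cases "e \<in> h ` \<C>")
      case True
      then obtain D where D: "D \<in> \<C>" "e = h D" by auto
      then have "rank D < rank C" using rank[of D C] e less.prems by auto
      then show ?thesis using less.hyps D by simp
    next
      case False
      then have "e \<in> ?E" using e sub less.prems by auto
      then show ?thesis by (auto simp: links_def)
    qed
    then have "links s t (C - {h C}) \<subseteq> (links s t ?E)\<^sup>*"
      using symE[of ?E] by (auto simp: links_def dest: symD)
    then show ?case using bridge[OF less.prems] rtrancl_subset_rtrancl by blast
  qed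
  have "links s t E \<subseteq> (links s t ?E)\<^sup>*"
  proof -
    have "(s e, t e) \<in> (links s t ?E)\<^sup>*" if "e \<in> E" for e
    proof (cases "e \<in> h ` \<C>")
      case True
      then show ?thesis using hC by auto
    next
      case False
      then have "e \<in> ?E" using that by auto
      then show ?thesis by (auto simp: links_def)
    qed
    then show ?thesis using symE[of ?E] by (auto simp: links_def dest: symD)
  qed
  then have "(links s t E)\<^sup>* \<subseteq> (links s t ?E)\<^sup>*" by (rule rtrancl_subset_rtrancl)
  then have "card V \<le> card ?E + 1" using conn \<open>finite E\<close> by (intro connected_card_le[of _ V r s t]) auto
  moreover have "inj_on h \<C>"
  proof (rule inj_onI, rule ccontr)
    fix C D assume "C \<in> \<C>" "D \<in> \<C>" "h C = h D" "C \<noteq> D"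
    then show False using rank[of C D] rank[of D C] h by (metis less_asym')
  qed
  then have "card (h ` \<C>) = card \<C>" by (rule card_image)
  moreover have hE: "h ` \<C> \<subseteq> E" using h sub by blast
  then have "card ?E = card E - card (h ` \<C>)" "card (h ` \<C>) \<le> card E"
    using \<open>finite E\<close> by (auto simp: card_Diff_subset finite_subset card_mono)
  ultimately show ?thesis by linarith
qed

section \<open>Small circuits in Rauzy graphs\<close>

text \<open>The bound on \<open>i\<close> keeps windows inside the string, beyond whose end
  \<open>!\<close> is unspecified.\<close>

definition factors :: "nat \<Rightarrow> 'a list \<Rightarrow> 'a list set" where
  "factors k x = (\<lambda>i. window ((!) x) i k) ` {i. i + k \<le> length x}"

lemma finite_factors [simp]: "finite (factors k x)"
proof -
  have "{i. i + k \<le> length x} \<subseteq> {..length x}" by auto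
  then show ?thesis unfolding factors_def using finite_subset by blast
qed

lemma factors_subwindow:
  assumes "window a i k \<in> factors k x" "t + l \<le> k"
  shows "window a (i + t) l \<in> factors l x"
proof -
  obtain j where j: "j + k \<le> length x" "window a i k = window ((!) x) j k"
    using assms by (auto simp: factors_def)
  have "a (i + t + s) = x ! (j + t + s)" if "s < l" for s
    using j(2) that assms(2) by (simp add: window_eq_iff add.assoc)
  then have "window a (i + t) l = window ((!) x) (j + t) l" by (simp add: window_eq_iff)
  then show ?thesis using j(1) assms(2) by (auto simp: factors_def)
qed

text \<open>With \<open>L \<le> m\<close> the windows of length \<open>m\<close> within one period
  are distinct, so the circuit is a simple cycle with exactly \<open>L\<close> edges.\<close>

definition small_circuits :: "nat \<Rightarrow> 'a list \<Rightarrow> 'a list set set" where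
  "small_circuits m x = {C. C \<subseteq> factors (Suc m) x \<and>
     (\<exists>a L. least_period a L \<and> L \<le> m \<and> C = circuit a (Suc m))}"

lemma finite_small_circuits [simp]: "finite (small_circuits m x)"
  by (rule finite_subset[of _ "Pow (factors (Suc m) x)"]) (auto simp: small_circuits_def)

text \<open>The distinguished edge of a circuit of length \<open>L\<close> has least period \<open>L\<close>, hence lies on
  no shorter circuit; circuits of equal length are disjoint.\<close>

lemma ex_private_edge:
  assumes "C \<in> small_circuits m x"
  shows "\<exists>e\<in>C. (butlast e, tl e) \<in> (links butlast tl (C - {e}))\<^sup>* \<and>
     (\<forall>D\<in>small_circuits m x. e \<in> D \<longrightarrow> C \<noteq> D \<longrightarrow> card C < card D)"
proof -
  obtain a L where L: "least_period a L" and "L \<le> m" and C: "C = circuit a (Suc m)"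
    using assms by (auto simp: small_circuits_def)
  obtain i where i: "\<And>p. 0 < p \<Longrightarrow> p < L \<Longrightarrow> \<exists>t. t + p < L \<and> a (i + t) \<noteq> a (i + t + p)"
    using ex_unbordered[OF L] by auto
  let ?e = "window a i (Suc m)"
  let ?R = "links butlast tl (C - {?e})"
  \<comment> \<open>From the target of \<open>?e\<close> the remaining \<open>L - 1\<close> edges
    lead around the circuit back to its source.\<close>
  have "(window a (Suc i) m, window a (Suc i + k) m) \<in> ?R\<^sup>*" if "k < L" for k
    using that
  proof (induction k)
    case (Suc k)
    let ?f = "window a (Suc i + k) (Suc m)"
    have "?f \<noteq> ?e" using window_neq[OF L, of "Suc m" i "Suc i + k"] Suc.prems \<open>L \<le> m\<close> by simp
    then have "?f \<in> C - {?e}" by (auto simp: C circuit_def)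
    then have "(butlast ?f, tl ?f) \<in> ?R" by (auto simp: links_def)
    then have "(window a (Suc i + k) m, window a (Suc i + Suc k) m) \<in> ?R"
      by (simp add: butlast_window tl_window)
    then show ?case using Suc by (simp add: rtrancl_into_rtrancl)
  qed simp
  from this[of "L - 1"] have "(window a (Suc i) m, window a (i + L) m) \<in> ?R\<^sup>*"
    using least_periodD(1)[OF L] by simp
  moreover have "window a (i + L) m = window a i m"
    using window_mod[of a L "i + L" m] window_mod[of a L i m] least_periodD(2)[OF L] by simp
  ultimately have "(window a i m, window a (Suc i) m) \<in> ?R\<^sup>*"
    using sym_rtrancl[OF sym_links] by (metis symD)
  then have 1: "(butlast ?e, tl ?e) \<in> ?R\<^sup>*" by (simp add: butlast_window tl_window)
  have 2: "card C < card D" if D: "D \<in> small_circuits m x" "?e \<in> D" "C \<noteq> D" for D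
  proof -
    obtain b M where M: "least_period b M" and "M \<le> m" and Db: "D = circuit b (Suc m)"
      using D(1) by (auto simp: small_circuits_def)
    obtain j where j: "?e = window b j (Suc m)" using D(2) by (auto simp: Db circuit_def)
    \<comment> \<open>A circuit of shorter period \<open>M\<close> through \<open>?e\<close> would
      give period \<open>M\<close> to the unbordered window of length \<open>L\<close> at
      \<open>i\<close>.\<close>
    have "\<not> M < L"
    proof
      assume "M < L"
      then obtain t where t: "t + M < L" "a (i + t) \<noteq> a (i + t + M)"
        using i least_periodD(1)[OF M] by blast
      have "a (i + s) = b (j + s)" if "s < L" for s
        using j that \<open>L \<le> m\<close> by (simp add: window_eq_iff)
      from this[of t] this[of "t + M"] t least_periodD(2)[OF M, of "j + t"] show False
        by (simp add: add.assoc)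
    qed
    moreover have "M \<noteq> L"
    proof
      assume "M = L"
      then show False using circuit_eqI[OF L _ _ j, of "Suc m"] M D(3) C Db \<open>L \<le> m\<close> by simp
    qed
    ultimately show ?thesis
      using card_circuit(1)[OF L, of "Suc m"] card_circuit(1)[OF M, of "Suc m"] \<open>L \<le> m\<close> \<open>M \<le> m\<close>
      by (simp add: C Db)
  qed
  show ?thesis using 1 2 by (intro bexI[of _ ?e]) (auto simp: C circuit_def)
qed

text \<open>Reading \<open>x\<close> from left to right visits every vertex, so the Rauzy graph is
  connected; the private edges, ranked by circuit length, make the circuits independent.\<close>

lemma card_small_circuits:
  assumes "Suc m \<le> length x"
  shows "card (factors m x) + card (small_circuits m x) \<le> card (factors (Suc m) x) + 1"
proof -
  let ?R = "links butlast tl (factors (Suc m) x)"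
  obtain h where h: "\<And>C. C \<in> small_circuits m x \<Longrightarrow> h C \<in> C \<and>
      (butlast (h C), tl (h C)) \<in> (links butlast tl (C - {h C}))\<^sup>* \<and>
      (\<forall>D\<in>small_circuits m x. h C \<in> D \<longrightarrow> C \<noteq> D \<longrightarrow> card C < card D)"
    using ex_private_edge[of _ m x] by metis
  have walk: "(window ((!) x) 0 m, window ((!) x) i m) \<in> ?R\<^sup>*" if "i + m \<le> length x" for i
    using that
  proof (induction i)
    case (Suc i)
    let ?f = "window ((!) x) i (Suc m)"
    have "?f \<in> factors (Suc m) x" using Suc.prems by (auto simp: factors_def)
    then have "(butlast ?f, tl ?f) \<in> ?R" by (auto simp: links_def)
    then have "(window ((!) x) i m, window ((!) x) (Suc i) m) \<in> ?R"
      by (simp add: butlast_window tl_window)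
    then show ?case using Suc by (simp add: rtrancl_into_rtrancl)
  qed simp
  show ?thesis
  proof (rule card_independent_cycles[where h = h and rank = card])
    fix v assume "v \<in> factors m x"
    then show "(window ((!) x) 0 m, v) \<in> ?R\<^sup>*" using walk by (auto simp: factors_def)
  qed (use h in \<open>auto simp: small_circuits_def\<close>)
qed

text \<open>The bounds telescope between at least one factor of length 1 and exactly one of length
  \<open>length x\<close>.\<close>

lemma sum_card_small_circuits:
  assumes "x \<noteq> []"
  shows "(\<Sum>m = 1..<length x. card (small_circuits m x)) \<le> length x - 1"
proof -
  have *: "(\<Sum>m = 1..<Suc k. card (small_circuits m x)) + card (factors 1 x)
      \<le> card (factors (Suc k) x) + k" if "Suc k \<le> length x" for k
    using that
  proof (induction k)
    case (Suc k)
    then show ?case using card_small_circuits[of "Suc k" x] by simp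
  qed simp
  obtain k where k: "length x = Suc k" using assms by (cases x) auto
  have "{i. i + length x \<le> length x} = {0}" by auto
  then have "card (factors (Suc k) x) = 1" using k by (simp add: factors_def)
  moreover have "factors 1 x \<noteq> {}" using k by (auto simp: factors_def)
  then have "card (factors 1 x) \<ge> 1" by (simp add: card_gt_0_iff Suc_le_eq)
  ultimately show ?thesis using *[of k] k by simp
qed

section \<open>Counting distinct squares\<close>

text \<open>Generators stand for their squares: a square determines its generator, so the
  cardinality counts distinct squares.\<close>

definition squares :: "'a list \<Rightarrow> 'a list set" where
  "squares x = {u. \<exists>i. square_at u x i}"

lemma occurs_at_iff:
  "occurs_at w x i \<longleftrightarrow> i + length w \<le> length x \<and> w = window ((!) x) i (length w)"
proof
  assume "occurs_at w x i"
  then show "i + length w \<le> length x \<and> w = window ((!) x) i (length w)"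
    by (auto simp: occurs_at_def list_eq_iff_nth_eq nth_append)
next
  assume *: "i + length w \<le> length x \<and> w = window ((!) x) i (length w)"
  then have "w = take (length w) (drop i x)"
    by (auto simp: list_eq_iff_nth_eq min_def)
  then have "x = take i x @ w @ drop (length w) (drop i x)"
    by (metis append_take_drop_id)
  then show "occurs_at w x i" using * unfolding occurs_at_def by (metis add_leD1 length_take min.absorb2)
qed

definition cyc :: "'a list \<Rightarrow> nat \<Rightarrow> 'a" where
  "cyc u i = u ! (i mod length u)"

lemma window_cyc: "window (cyc u) 0 (length u) = u"
  by (simp add: list_eq_iff_nth_eq cyc_def)

lemma window_cyc2: "window (cyc u) 0 (2 * length u) = u @ u"
  using window_append[of "cyc u" 0 "length u" "length u"] window_cyc[of u]
  by (simp add: mult_2) (simp add: list_eq_iff_nth_eq cyc_def)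

lemma cyc_periodic: "cyc u (i + length u) = cyc u i"
  by (simp add: cyc_def)

lemma squares_iff: "u \<in> squares x \<longleftrightarrow> u \<noteq> [] \<and> u @ u \<in> factors (2 * length u) x"
  by (auto simp: squares_def square_at_def occurs_at_iff factors_def mult_2)

lemma finite_squares [simp]: "finite (squares x)"
proof (rule finite_subset)
  show "squares x \<subseteq> {w. set w \<subseteq> set x \<and> length w \<le> length x}"
    by (auto simp: squares_def square_at_def occurs_at_def)
  show "finite {w. set w \<subseteq> set x \<and> length w \<le> length x}"
    by (rule finite_lists_length_le) simp
qed

text \<open>The window length is itself a period, so repeating the window reproduces the sequence
  from \<open>i\<close> on.\<close>

lemma shift_eq_cyc:
  assumes L: "least_period a L" and "L dvd k" "k > 0"
  shows "cyc (window a i k) t = a (i + t)"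
proof -
  obtain c where c: "k = c * L" using \<open>L dvd k\<close> by (auto simp: dvd_def mult.commute)
  have "a (j + k) = a j" for j
    using periodic_mult[of a L j c] least_periodD(2)[OF L] by (simp add: c)
  then have "a (i + t mod k) = a (i + t)"
    using periodic_mult[of a k "i + t mod k" "t div k"] by (simp add: add.assoc)
  then show ?thesis using \<open>k > 0\<close> by (simp add: cyc_def)
qed

text \<open>If more than \<open>j\<close> of the rotations of a word with root length \<open>L\<close> have their squares in
  \<open>x\<close>, these squares cover the whole circuit of order \<open>2 k - L + j\<close>: each contributes \<open>L - j\<close>
  consecutive edges, so by the pigeonhole principle no edge is missed.\<close>

lemma circuit_subset_factors:
  assumes L: "least_period a L" and "L dvd k" "k > 0"
    and j: "j < card {v \<in> squares x. v \<in> circuit a k}"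
  shows "j < L" "circuit a (Suc (2 * k - L + j)) \<subseteq> factors (Suc (2 * k - L + j)) x"
proof -
  have "L \<le> k" using assms by (simp add: dvd_imp_le)
  define S where "S = {i. i < L \<and> window a i k \<in> squares x}"
  have "{v \<in> squares x. v \<in> circuit a k} = (\<lambda>i. window a i k) ` S"
    by (auto simp: circuit_eq_image[OF L] S_def)
  moreover have "inj_on (\<lambda>i. window a i k) S"
    using inj_on_window[OF L \<open>L \<le> k\<close>] by (rule inj_on_subset) (auto simp: S_def)
  ultimately have "j < card S" using j by (simp add: card_image)
  moreover have "S \<subseteq> {..<L}" by (auto simp: S_def)
  then have "card S \<le> L" using card_mono[of "{..<L}" S] by simp
  ultimately show "j < L" by simp
  show "circuit a (Suc (2 * k - L + j)) \<subseteq> factors (Suc (2 * k - L + j)) x"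
  proof
    let ?n = "Suc (2 * k - L + j)"
    fix e assume "e \<in> circuit a ?n"
    then obtain i where "e = window a i ?n" "i < L" by (auto simp: circuit_eq_image[OF L])
    \<comment> \<open>Starts, modulo \<open>L\<close>, from which a square of length
      \<open>2 * k\<close> covers the window at \<open>i\<close>: the lead \<open>t\<close> needs
      \<open>t + ?n \<le> 2 * k\<close>, that is, \<open>t < L - j\<close>.\<close>
    define T where "T = (\<lambda>t. (i + L - t) mod L) ` {..<L - j}"
    have "inj_on (\<lambda>t. (i + L - t) mod L) {..<L - j}"
    proof (rule linorder_inj_onI)
      fix s t assume st: "s < t" "s \<in> {..<L - j}" "t \<in> {..<L - j}"
      show "(i + L - s) mod L \<noteq> (i + L - t) mod L"
      proof
        assume "(i + L - s) mod L = (i + L - t) mod L"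
        then have "L dvd (i + L - s) - (i + L - t)" using st by (simp add: mod_eq_dvd_iff_nat)
        then have "L dvd t - s" using st by simp
        then show False using st by (auto dest: dvd_imp_le)
      qed
    qed auto
    then have "card T = L - j" by (simp add: T_def card_image)
    \<comment> \<open>More than \<open>j\<close> residues in \<open>S\<close> and
      \<open>L - j\<close> in \<open>T\<close> cannot be disjoint among \<open>L\<close>
      residues.\<close>
    have "S \<inter> T \<noteq> {}"
    proof
      assume "S \<inter> T = {}"
      have "T \<subseteq> {..<L}" using \<open>i < L\<close> by (auto simp: T_def)
      have "card (S \<union> T) = card S + card T"
        using \<open>S \<inter> T = {}\<close> \<open>S \<subseteq> _\<close> \<open>T \<subseteq> _\<close> by (intro card_Un_disjoint) (auto intro: finite_subset)
      moreover have "card (S \<union> T) \<le> L" using card_mono[of "{..<L}" "S \<union> T"] \<open>S \<subseteq> _\<close> \<open>T \<subseteq> _\<close> by simp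
      ultimately show False using \<open>card T = L - j\<close> \<open>j < card S\<close> \<open>j < L\<close> by simp
    qed
    then obtain t where t: "t < L - j" "(i + L - t) mod L \<in> S" by (auto simp: T_def)
    let ?s = "(i + L - t) mod L" and ?v = "window a ((i + L - t) mod L) k"
    have "cyc ?v r = a (?s + r)" for r by (rule shift_eq_cyc) fact+
    then have "window a ?s (2 * k) = ?v @ ?v"
      using window_cyc2[of ?v] by (simp add: window_eq_iff list_eq_iff_nth_eq)
    then have "window a ?s (2 * k) \<in> factors (2 * k) x"
      using t(2) by (simp add: S_def squares_iff)
    moreover have "t + ?n \<le> 2 * k" using t \<open>L \<le> k\<close> by simp
    ultimately have "window a (?s + t) ?n \<in> factors ?n x" by (rule factors_subwindow)
    moreover have "(?s + t) mod L = i"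
    proof -
      have "(?s + t) mod L = ((i + L - t) + t) mod L" by (simp add: mod_add_left_eq)
      then show ?thesis using t \<open>i < L\<close> by simp
    qed
    ultimately show "e \<in> factors ?n x"
      using window_mod[of a L "?s + t" ?n] least_periodD(2)[OF L] \<open>e = _\<close> by simp
  qed
qed

text \<open>For distinct multiples of \<open>L\<close> the values \<open>2 * k\<close> differ by at
  least \<open>2 * L\<close>, so the ranges from \<open>2 * k - L\<close> to below
  \<open>2 * k\<close> are disjoint. Thus order and root length recover the length of a
  generator.\<close>

lemma multiple_unique:
  fixes L :: nat
  assumes "L dvd k" "L dvd k'" "2 * k - L \<le> m" "m < 2 * k" "2 * k' - L \<le> m" "m < 2 * k'"
  shows "k = k'"
proof -
  obtain c c' where c: "k = L * c" "k' = L * c'" using assms by (auto simp: dvd_def)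
  have "\<not> c < c'" if "k = L * c" "k' = L * c'" "m < 2 * k" "2 * k' - L \<le> m" for c c' k k'
  proof
    assume "c < c'"
    then have "L * Suc c \<le> L * c'" by (intro mult_le_mono) auto
    then show False using that by (simp add: algebra_simps)
  qed
  from this[of k c k' c'] this[of k' c' k c] have "c = c'" using c assms by simp
  then show ?thesis using c by simp
qed

lemma card_squares_le:
  assumes "x \<noteq> []"
  shows "card (squares x) \<le> length x - 1"
proof -
  define root where "root u = (SOME L. least_period (cyc u) L)" for u :: "'a list"
  have root: "least_period (cyc u) (root u)" if "u \<in> squares x" for u
    unfolding root_def
    by (rule someI_ex, rule ex_least_period[of "length u"])
      (use that in \<open>simp_all add: cyc_periodic squares_iff\<close>)
  have dvd: "root u dvd length u" "length u > 0" "root u \<le> length u" "root u > 0"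
    if "u \<in> squares x" for u
    using least_period_dvd[OF root[OF that] cyc_periodic] that least_periodD(1)[OF root[OF that]]
    by (auto simp: squares_iff dvd_imp_le)
  \<comment> \<open>An arbitrary numbering, used only to rank the rotations within a class.\<close>
  obtain num :: "'a list \<Rightarrow> nat" where num: "inj_on num (squares x)"
    using finite_imp_inj_to_nat_seg[OF finite_squares, of x] by blast
  define cls where "cls u = {v \<in> squares x. v \<in> circuit (cyc u) (length u)}" for u
  define idx where "idx u = card {v \<in> cls u. num v < num u}" for u
  define ord where "ord u = 2 * length u - root u + idx u" for u
  define g where "g u = (ord u, circuit (cyc u) (Suc (ord u)))" for u
  have fin: "finite (cls u)" for u by (simp add: cls_def)
  have self: "u \<in> cls u" if "u \<in> squares x" for u
    using that rangeI[of "\<lambda>i. window (cyc u) i (length u)" 0]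
    by (simp add: cls_def circuit_def window_cyc)
  have idx: "idx u < card (cls u)" if "u \<in> squares x" for u
    unfolding idx_def using self[OF that] fin by (intro psubset_card_mono) auto
  have small: "idx u < root u" "circuit (cyc u) (Suc (ord u)) \<subseteq> factors (Suc (ord u)) x"
    if "u \<in> squares x" for u
    using circuit_subset_factors[OF root[OF that], of "length u" "idx u" x] dvd[OF that] idx[OF that]
    by (simp_all add: cls_def ord_def)
  have ord: "root u \<le> ord u" "2 * length u - root u \<le> ord u" "ord u < 2 * length u"
    if "u \<in> squares x" for u
    using dvd[OF that] small(1)[OF that] by (auto simp: ord_def)
  have "g ` squares x \<subseteq> Sigma {1..<length x} (\<lambda>m. small_circuits m x)"
  proof (rule image_subsetI)
    fix u assume u: "u \<in> squares x"
    have "length (u @ u) \<le> length x"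
      using u by (auto simp: squares_iff factors_def simp flip: mult_2)
    then have "ord u < length x" using ord(3)[OF u] by simp
    moreover have "circuit (cyc u) (Suc (ord u)) \<in> small_circuits (ord u) x"
      using small(2)[OF u] root[OF u] ord(1)[OF u] by (auto simp: small_circuits_def)
    ultimately show "g u \<in> Sigma {1..<length x} (\<lambda>m. small_circuits m x)"
      using ord(1)[OF u] dvd(4)[OF u] by (simp add: g_def)
  qed
  moreover have "inj_on g (squares x)"
  proof (rule inj_onI)
    fix u v assume u: "u \<in> squares x" and v: "v \<in> squares x" and "g u = g v"
    then have m: "ord u = ord v"
      and "circuit (cyc u) (Suc (ord u)) = circuit (cyc v) (Suc (ord v))"
      unfolding g_def prod.inject by blast+
    then have C: "circuit (cyc u) (Suc (ord u)) = circuit (cyc v) (Suc (ord u))" by simp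
    \<comment> \<open>The root length is the number of edges of the circuit.\<close>
    have L: "root u = root v"
      using card_circuit(1)[OF root[OF u], of "Suc (ord u)"]
        card_circuit(1)[OF root[OF v], of "Suc (ord u)"] ord(1)[OF u] ord(1)[OF v] C m by simp
    have len: "length u = length v"
      by (rule multiple_unique[of "root u" _ _ "ord u"])
        (use ord[OF u] ord[OF v] dvd[OF u] dvd[OF v] L m in simp_all)
    have "window (cyc u) 0 (Suc (ord u)) \<in> circuit (cyc v) (Suc (ord u))"
      unfolding C[symmetric] by (simp add: circuit_def)
    then obtain j where "window (cyc u) 0 (Suc (ord u)) = window (cyc v) j (Suc (ord u))"
      by (auto simp: circuit_def)
    then have "circuit (cyc u) (length u) = circuit (cyc v) (length u)"
      using circuit_eqI[OF root[OF u]] root[OF v] L ord(1)[OF u] by (metis le_SucI)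
    then have cls: "cls u = cls v" by (simp add: cls_def len)
    have idx_eq: "idx u = idx v" using m L len by (simp add: ord_def)
    \<comment> \<open>\<open>u'\<close> is counted in the index of \<open>v'\<close> but not in its
      own.\<close>
    have mono: "idx u' < idx v'" if "cls u' = cls v'" "num u' < num v'" "u' \<in> squares x" for u' v'
    proof -
      have "{w \<in> cls u'. num w < num u'} \<subset> {w \<in> cls v'. num w < num v'}"
        using that self[OF that(3)] by auto
      then show ?thesis unfolding idx_def using fin by (intro psubset_card_mono) auto
    qed
    have "num u = num v" using mono[of u v] mono[of v u] cls idx_eq u v by force
    then show "u = v" using num u v by (simp add: inj_on_def)
  qed
  ultimately have "card (squares x) \<le> card (Sigma {1..<length x} (\<lambda>m. small_circuits m x))"
    by (intro card_inj_on_le[of g]) auto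
  also have "\<dots> \<le> length x - 1" using sum_card_small_circuits[OF assms] by simp
  finally show ?thesis .
qed

section \<open>At most two rightmost squares per position\<close>

text \<open>The periodicity lemma of Fine and Wilf for \<open>p + q \<le> n\<close>, by the
  subtractive Euclidean algorithm: the difference of the two periods is again a period.\<close>

lemma gcd_period:
  fixes s :: "nat \<Rightarrow> 'a"
  assumes "p > 0" "q > 0" "p + q \<le> n"
    and "\<And>t. t + p < n \<Longrightarrow> s (t + p) = s t" "\<And>t. t + q < n \<Longrightarrow> s (t + q) = s t"
    and "t + gcd p q < n"
  shows "s (t + gcd p q) = s t"
  using assms
proof (induction "p + q" arbitrary: p q t rule: less_induct)
  case less
  have step: "s (t + (q' - p')) = s t"
    if lt: "p' < q'" and n: "p' + q' \<le> n" and t: "t + (q' - p') < n"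
      and p: "\<And>t. t + p' < n \<Longrightarrow> s (t + p') = s t" and q: "\<And>t. t + q' < n \<Longrightarrow> s (t + q') = s t"
    for p' q' t
  \<comment> \<open>Go forward by \<open>q'\<close> and then back by \<open>p'\<close>; near the end
    of the range, go back first.\<close>
  proof (cases "t + q' < n")
    case True
    then show ?thesis using p[of "t + (q' - p')"] q[of t] lt by simp
  next
    case False
    then have "p' \<le> t" using n by simp
    then show ?thesis using p[of "t - p'"] q[of "t - p'"] t lt by simp
  qed
  consider "p = q" | "p < q" | "q < p" by linarith
  then show ?case
  proof cases
    case 1
    then show ?thesis using less.prems by simp
  next
    case 2
    then have g: "gcd p (q - p) = gcd p q" by (metis gcd_diff1_nat gcd.commute less_imp_le)
    show ?thesis
      using less.hyps[of p "q - p" t] less.prems 2 step[of p q] by (simp add: g)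
  next
    case 3
    then have g: "gcd (p - q) q = gcd p q" by (simp add: gcd_diff1_nat)
    show ?thesis
      using less.hyps[of "p - q" q t] less.prems 3 step[of q p] by (simp add: g)
  qed
qed

text \<open>The shortest square recurs inside the longest. If \<open>2 * p \<le> r\<close>, shift by
  \<open>r\<close>. Otherwise \<open>q - p\<close> and \<open>r - q\<close> are periods of the
  prefix of length \<open>p\<close>; their gcd is then a period of the prefix of length
  \<open>r + p\<close> and serves as the shift.\<close>

lemma three_squares:
  fixes s :: "nat \<Rightarrow> 'a"
  assumes "0 < p" "p < q" "q < r"
    and P: "\<And>t. t < p \<Longrightarrow> s (t + p) = s t" and Q: "\<And>t. t < q \<Longrightarrow> s (t + q) = s t"
    and R: "\<And>t. t < r \<Longrightarrow> s (t + r) = s t"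
  shows "\<exists>d>0. d + 2 * p \<le> 2 * r \<and> (\<forall>t<2 * p. s (d + t) = s t)"
proof (cases "2 * p \<le> r")
  case True
  then show ?thesis using R assms by (intro exI[of _ r]) (auto simp: add.commute)
next
  case False
  define d e where "d = q - p" and "e = r - q"
  define g where "g = gcd d e"
  have de: "q = p + d" "r = p + d + e" "d > 0" "e > 0" "d + e < p"
    using assms False by (auto simp: d_def e_def)
  have "g > 0" using de by (simp add: g_def)
  have "g \<le> d" "g \<le> e" using de by (auto simp: g_def)
  have perd: "s (t + d) = s t" if "t + d < p" for t
    using P[of "t + d"] Q[of t] that de by (simp add: ac_simps)
  have pere: "s (t + e) = s t" if "t + e < p" for t
    using Q[of "t + e"] R[of t] that de by (simp add: ac_simps)
  have left: "s (t + g) = s t" if "t + g < p" for t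
    unfolding g_def
    by (rule gcd_period[of d e p]) (use de perd pere that g_def in auto)
  have right: "s (t + g) = s t" if "p \<le> t" "t + g < r + p" for t
  proof -
    \<comment> \<open>Copies of the prefix of length \<open>p\<close> start at \<open>p\<close>,
      \<open>q\<close> and \<open>r\<close>. Consecutive ones overlap in more than \<open>g\<close>
      letters, so any two positions at distance \<open>g\<close> lie in a common copy.\<close>
    consider "t + g < 2 * p" | "q \<le> t" "t + g < q + p" | "r \<le> t"
      using that de \<open>g \<le> d\<close> \<open>g \<le> e\<close> by linarith
    then show ?thesis
    proof cases
      case 1
      then show ?thesis using left[of "t - p"] P[of "t - p"] P[of "t - p + g"] that by simp
    next
      case 2
      then show ?thesis using left[of "t - q"] Q[of "t - q"] Q[of "t - q + g"] de by simp
    next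
      case 3
      then show ?thesis using left[of "t - r"] R[of "t - r"] R[of "t - r + g"] that de by simp
    qed
  qed
  have "s (t + g) = s t" if "t + g < r + p" for t
  proof -
    consider "t + g < p" | "t < p" "p \<le> t + g" | "p \<le> t" by linarith
    then show ?thesis
    proof cases
      \<comment> \<open>A pair straddling \<open>p\<close> is moved by \<open>q\<close> into the
        range of \<open>right\<close>.\<close>
      case 2
      have "s (t + q + g) = s (t + q)" using 2 right[of "t + q"] de \<open>g \<le> d\<close> \<open>g \<le> e\<close> by simp
      then show ?thesis using Q[of t] Q[of "t + g"] 2 de \<open>g \<le> d\<close> by (simp add: ac_simps)
    qed (use left right that in auto)
  qed
  then have "\<forall>t<2 * p. s (g + t) = s t" using de \<open>g \<le> e\<close> by (simp add: add.commute)
  moreover have "g + 2 * p \<le> 2 * r" using de \<open>g \<le> e\<close> by simp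
  ultimately show ?thesis using \<open>g > 0\<close> by auto
qed

lemma square_at_iff:
  "square_at u x i \<longleftrightarrow> u \<noteq> [] \<and> i + 2 * length u \<le> length x \<and>
     u = window ((!) x) i (length u) \<and> (\<forall>t<length u. x ! (i + (t + length u)) = x ! (i + t))"
proof -
  have "u @ u = window ((!) x) i (length (u @ u)) \<longleftrightarrow>
      u = window ((!) x) i (length u) \<and> u = window ((!) x) (i + length u) (length u)"
    using window_append[of "(!) x" i "length u" "length u"] by simp
  also have "\<dots> \<longleftrightarrow> u = window ((!) x) i (length u) \<and>
      (\<forall>t<length u. x ! (i + (t + length u)) = x ! (i + t))"
    by (auto simp: list_eq_iff_nth_eq ac_simps)
  finally show ?thesis by (simp add: square_at_def occurs_at_iff mult_2)
qed

text \<open>By \<open>three_squares\<close> the shortest square reappears at a larger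
  position.\<close>

lemma not_three_rightmost:
  assumes u: "rightmost_square_at u x i" and v: "square_at v x i" and w: "square_at w x i"
    and "length u < length v" "length v < length w"
  shows False
proof -
  let ?s = "\<lambda>t. x ! (i + t)" and ?p = "length u"
  have u': "square_at u x i" using u by (simp add: rightmost_square_at_def)
  have "\<exists>d>0. d + 2 * ?p \<le> 2 * length w \<and> (\<forall>t<2 * ?p. ?s (d + t) = ?s t)"
    using u' v w assms(4,5) by (intro three_squares[of _ "length v"]) (auto simp: square_at_iff)
  then obtain d where d: "d > 0" "d + 2 * ?p \<le> 2 * length w"
    and eq: "\<And>t. t < 2 * ?p \<Longrightarrow> x ! (i + d + t) = x ! (i + t)" by (auto simp: add.assoc)
  have uw: "u = window ((!) x) i ?p" using u' by (simp add: square_at_iff)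
  also have "\<dots> = window ((!) x) (i + d) ?p" using eq by (simp add: window_eq_iff)
  finally have "u = window ((!) x) (i + d) ?p" .
  moreover have "x ! (i + d + (t + ?p)) = x ! (i + d + t)" if "t < ?p" for t
    using eq[of t] eq[of "t + ?p"] that u' by (simp add: square_at_iff)
  ultimately have "square_at u x (i + d)" using u' w d by (simp add: square_at_iff)
  then show False using u \<open>d > 0\<close> by (simp add: rightmost_square_at_def)
qed

section \<open>Charging FS-double squares to their two generators\<close>

lemma square_at_eqI:
  assumes "square_at u x i" "square_at v x i" "length u = length v"
  shows "u = v"
  using assms by (metis square_at_iff)

lemma rightmost_unique:
  assumes "rightmost_square_at u x i" "rightmost_square_at u x j"
  shows "i = j"
  using assms by (metis linorder_neqE_nat rightmost_square_at_def)

text \<open>A shared generator forces a shared position. There, generators of three different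
  lengths would contradict \<open>not_three_rightmost\<close>.\<close>

lemma FS_double_squares_disjoint:
  assumes "(i, u, U) \<in> FS_double_squares x" "(j, v, V) \<in> FS_double_squares x"
    and "{u, U} \<inter> {v, V} \<noteq> {}"
  shows "(i, u, U) = (j, v, V)"
proof -
  have D: "rightmost_square_at u x i" "rightmost_square_at U x i" "length u < length U"
    "rightmost_square_at v x j" "rightmost_square_at V x j" "length v < length V"
    using assms(1,2) by (auto simp: FS_double_squares_def double_square_at_def)
  then have ij: "i = j" using assms(3) rightmost_unique by fast
  have sq: "square_at u x i" "square_at U x i" "square_at v x i" "square_at V x i"
    using D ij by (auto simp: rightmost_square_at_def)
  have "length u = length v"
  proof (rule ccontr)
    assume "length u \<noteq> length v"
    then consider "length u < length v" | "length v < length u" by linarith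
    then show False
      using not_three_rightmost[of u x i v V] not_three_rightmost[of v x i u U] D sq ij by cases auto
  qed
  then have "u = v" using square_at_eqI sq by blast
  moreover have "length U = length V"
  proof (rule ccontr)
    assume "length U \<noteq> length V"
    then consider "length U < length V" | "length V < length U" by linarith
    then show False
      using not_three_rightmost[of u x i U V] not_three_rightmost[of u x i V U] D sq \<open>u = v\<close>
      by cases auto
  qed
  then have "U = V" using square_at_eqI sq by blast
  ultimately show ?thesis using ij by simp
qed

lemma card_FS_double_squares: "2 * card (FS_double_squares x) \<le> card (squares x)"
proof -
  let ?F = "FS_double_squares x" and ?P = "\<lambda>(i :: nat, u, U). {u, U}"
  have "card (\<Union> (?P ` ?F)) = (\<Sum>D\<in>?F. card (?P D))"
  proof (rule card_UN_disjoint)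
    show "\<forall>D\<in>?F. \<forall>E\<in>?F. D \<noteq> E \<longrightarrow> ?P D \<inter> ?P E = {}"
    proof (intro ballI impI)
      fix D E assume D: "D \<in> ?F" "E \<in> ?F" "D \<noteq> E"
      obtain i u U j v V where "D = (i, u, U)" "E = (j, v, V)" by (metis prod_cases3)
      then show "?P D \<inter> ?P E = {}"
        using FS_double_squares_disjoint[of i u U x j v V] D by auto
    qed
  qed (auto simp: finite_FS_double_squares)
  also have "\<dots> = (\<Sum>D\<in>?F. 2)"
    by (rule sum.cong)
      (auto simp: FS_double_squares_def double_square_at_def card_insert_if)
  finally have "2 * card ?F = card (\<Union> (?P ` ?F))" by simp
  also have "\<dots> \<le> card (squares x)"
    by (rule card_mono[OF finite_squares])
      (auto simp: FS_double_squares_def double_square_at_def squares_def)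
  finally show ?thesis .
qed

theorem theorem32:
  fixes A :: "'a set" and x :: "'a list" and n :: nat
  assumes "finite A" and "x \<in> lists A" and "n > 0" and "length x = n"
  shows "int (card (FS_double_squares x)) \<le> \<lfloor>5 * real n / 6\<rfloor>"
proof -
  have "x \<noteq> []" using assms by auto
  \<comment> \<open>This gives at most \<open>n / 2\<close> double squares, which is below the
    required bound.\<close>
  then have "2 * card (FS_double_squares x) \<le> n"
    using card_FS_double_squares[of x] card_squares_le[of x] assms by linarith
  then have "real (card (FS_double_squares x)) \<le> 5 * real n / 6" by linarith
  then show ?thesis by (simp add: le_floor_iff)
qed

end
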